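(* Let $k\ge 2$ and $q\ge 1$ be integers, and let $m_{k,q}$ be the minimum, over all Sperner labelings of the vertex set $\Delta_{k,q}\cap\mathbb{Z}^k$, of the number of non-monochromatic simplices of the regular triangulation $\mathcal{T}$ of $\Delta_{k,q}$. Then \[ m_{k,q}\ \ge\ \binom{q+k-3}{k-2}. \]
   Context: $\Delta_{k,q}=\mathrm{Conv}\{(q,0,\dots,0),\dots,(0,\dots,0,q)\}=\{x\in\mathbb{R}^k: x_i\ge 0,\ \sum_i x_i=q\}$, with lattice points $\Delta_{k,q}\cap\mathbb{Z}^k$. Let $R_{k,q}=\{y\in\mathbb{R}^{k-1}: 0\le y_1\le y_2\le\dots\le y_{k-1}\le q\}$ and $W_{k,q}=R_{k,q}\cap\mathbb{Z}^{k-1}$. A permutation $\pi$ of $\{1,\dots,k-1\}$ is consistent with $w\in W_{k,q}$ if $w_i=w_{i+1}$ implies $\pi(i)<\pi(i+1)$. For such $(w,\pi)$ let $\sigma(w,\pi)=\{y\in\mathbb{R}^{k-1}: y_i\ge 0 \text{ for all } i,\ 0\le (y-w)_{\pi(1)}\le\dots\le (y-w)_{\pi(k-1)}\le 1\}$. Let $\phi:R_{k,q}\to\Delta_{k,q}$, $\phi(y_1,\dots,y_{k-1})=(y_1,y_2-y_1,\dots,y_{k-1}-y_{k-2},q-y_{k-1})$. The regular triangulation is $\mathcal{T}=\{\phi(\sigma(w,\pi)) : w\in W_{k,q},\ \pi \text{ consistent with } w\}$; its vertices are the points of $\Delta_{k,q}\cap\mathbb{Z}^k$. A Sperner labeling is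 a map $c:\Delta_{k,q}\cap\mathbb{Z}^k\to\{1,\dots,k\}$ such that $v_i=0$ implies $c(v)\ne i$. A simplex of $\mathcal{T}$ is monochromatic if all its vertices receive the same label, and non-monochromatic otherwise.
   Formalization: Consistency of π with w is taken as: w_i=w_{i+1} implies π^{-1}(i)<π^{-1}(i+1) (as printed, some σ(w,π) leave R_{k,q} when k≥4), and only simplices σ(w,π) contained in R_{k,q} are used, which excludes w with w_{k-1}=q. *)

theory Defs
  imports Complex_Main "HOL-Combinatorics.Permutations"
begin

text \<open>The dimension varies with k, so a point of n-dimensional real space is a function on the
  naturals with coordinates 1, ..., n, normalised to be 0 at every other index. This makes equality
  of points, and hence of simplices as sets of points, the usual one.\<close>

definition rspace :: "nat \<Rightarrow> (nat \<Rightarrow> real) set" where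
  "rspace n = {x. \<forall>i. i \<notin> {1..n} \<longrightarrow> x i = 0}"

definition lattice_points :: "nat \<Rightarrow> (nat \<Rightarrow> real) set" where
  "lattice_points n = {x \<in> rspace n. \<forall>i. x i \<in> \<int>}"

definition Delta :: "nat \<Rightarrow> nat \<Rightarrow> (nat \<Rightarrow> real) set" where
  "Delta k q = {x \<in> rspace k. (\<forall>i\<in>{1..k}. 0 \<le> x i) \<and> (\<Sum>i=1..k. x i) = real q}"

text \<open>In the chains of inequalities below, k is at least 2, so that coordinates 1 and k - 1
  exist.\<close>

definition R :: "nat \<Rightarrow> nat \<Rightarrow> (nat \<Rightarrow> real) set" where
  "R k q = {y \<in> rspace (k - 1).
     0 \<le> y 1 \<and> (\<forall>i\<in>{1..<k - 1}. y i \<le> y (i + 1)) \<and> y (k - 1) \<le> real q}"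

definition W :: "nat \<Rightarrow> nat \<Rightarrow> (nat \<Rightarrow> real) set" where
  "W k q = R k q \<inter> lattice_points (k - 1)"

text \<open>A permutation is used in \<open>sigma\<close> as the list of coordinates in increasing order of
  the entries of y - w. If coordinates i and i + 1 of w agree, then y can be in \<open>R\<close> only if i
  comes before i + 1 in that list. The position of i in the list is the value of the inverse
  permutation at i, which is why the inverse occurs here: comparing the values of the
  permutation itself at i and i + 1 would, from k = 4 on, admit simplices outside \<open>R\<close>
  and leave gaps.\<close>

definition consistent :: "nat \<Rightarrow> (nat \<Rightarrow> real) \<Rightarrow> (nat \<Rightarrow> nat) \<Rightarrow> bool" where
  "consistent k w \<pi> \<longleftrightarrow> \<pi> permutes {1..k - 1} \<and>
     (\<forall>i\<in>{1..<k - 1}. w i = w (i + 1) \<longrightarrow> inv \<pi> i < inv \<pi> (i + 1))"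

definition sigma :: "nat \<Rightarrow> (nat \<Rightarrow> real) \<Rightarrow> (nat \<Rightarrow> nat) \<Rightarrow> (nat \<Rightarrow> real) set" where
  "sigma k w \<pi> = {y \<in> rspace (k - 1).
     (\<forall>i\<in>{1..k - 1}. 0 \<le> y i) \<and>
     0 \<le> y (\<pi> 1) - w (\<pi> 1) \<and>
     (\<forall>i\<in>{1..<k - 1}. y (\<pi> i) - w (\<pi> i) \<le> y (\<pi> (i + 1)) - w (\<pi> (i + 1))) \<and>
     y (\<pi> (k - 1)) - w (\<pi> (k - 1)) \<le> 1}"

definition phi :: "nat \<Rightarrow> nat \<Rightarrow> (nat \<Rightarrow> real) \<Rightarrow> (nat \<Rightarrow> real)" where
  "phi k q y = (\<lambda>i. if i = 1 then y 1
                    else if i \<in> {2..k - 1} then y i - y (i - 1)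
                    else if i = k then real q - y (k - 1)
                    else 0)"

text \<open>The map \<open>phi\<close> is a map from \<open>R\<close> to \<open>Delta\<close>, so only simplices inside
  \<open>R\<close> are transported. For consistent pairs this excludes exactly the w whose last coordinate
  is q, since w + (1, ..., 1) always belongs to \<open>sigma\<close>.\<close>

definition triangulation :: "nat \<Rightarrow> nat \<Rightarrow> (nat \<Rightarrow> real) set set" where
  "triangulation k q =
     {phi k q ` sigma k w \<pi> | w \<pi>. w \<in> W k q \<and> consistent k w \<pi> \<and> sigma k w \<pi> \<subseteq> R k q}"

text \<open>Vertices are extreme points. This repeats the definition of \<open>extreme_point_of\<close>, which
  needs a type of class \<open>real_vector\<close>.\<close>

definition vertices :: "(nat \<Rightarrow> real) set \<Rightarrow> (nat \<Rightarrow> real) set" where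
  "vertices S = {x \<in> S. \<not> (\<exists>a\<in>S. \<exists>b\<in>S. \<exists>t::real.
     a \<noteq> b \<and> 0 < t \<and> t < 1 \<and> x = (\<lambda>i. (1 - t) * a i + t * b i))}"

definition sperner_labeling :: "nat \<Rightarrow> nat \<Rightarrow> ((nat \<Rightarrow> real) \<Rightarrow> nat) \<Rightarrow> bool" where
  "sperner_labeling k q c \<longleftrightarrow>
     (\<forall>v \<in> Delta k q \<inter> lattice_points k.
        c v \<in> {1..k} \<and> (\<forall>i\<in>{1..k}. v i = 0 \<longrightarrow> c v \<noteq> i))"

definition monochromatic :: "((nat \<Rightarrow> real) \<Rightarrow> nat) \<Rightarrow> (nat \<Rightarrow> real) set \<Rightarrow> bool" where
  "monochromatic c S \<longleftrightarrow> (\<forall>u\<in>vertices S. \<forall>v\<in>vertices S. c u = c v)"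

definition num_nonmono :: "nat \<Rightarrow> nat \<Rightarrow> ((nat \<Rightarrow> real) \<Rightarrow> nat) \<Rightarrow> nat" where
  "num_nonmono k q c = card {S \<in> triangulation k q. \<not> monochromatic c S}"

definition min_nonmono :: "nat \<Rightarrow> nat \<Rightarrow> nat" where
  "min_nonmono k q = Min {num_nonmono k q c | c. sperner_labeling k q c}"

end

(* After Mirzakhani and Vondrak. For the identity permutation, the simplices of the
   triangulation are the cells with vertices b + e_1, ..., b + e_k, where b runs through the lattice
   points with coordinate sum q - 1. If such a cell is monochromatic with label i, then the vertex
   b + e_j with j different from i has label i, so b_i >= 1. The map sending b to b - e_i + e_k is
   injective on monochromatic cells: if b - e_i = b' - e_j with labels i and j different, then the
   point b + e_j = b' + e_i would have both labels. Its values have positive last coordinate, so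
   there are at least as many non-monochromatic cells as lattice points b with b_k = 0. *)

theory Submission imports Defs begin

section \<open>Counting lattice points\<close>

abbreviation lattice_Delta :: "nat \<Rightarrow> nat \<Rightarrow> (nat \<Rightarrow> real) set" where
  "lattice_Delta k q \<equiv> Delta k q \<inter> lattice_points k"

text \<open>This reduces counting to lists of naturals with given length and sum, where stars and
  bars is \<open>card_length_sum_list\<close>. List positions start at 0 and coordinates at 1, hence
  the shifts by one.\<close>

lemma bij_betw_lists_lattice_Delta:
  "bij_betw (\<lambda>l i. if i \<in> {1..n} then real (l ! (i - 1)) else 0)
     {l. length l = n \<and> sum_list l = m} (lattice_Delta n m)"
proof (rule bij_betw_byWitness[where f' = "\<lambda>x. map (\<lambda>i. nat \<lfloor>x (Suc i)\<rfloor>) [0..<n]"])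
  let ?f = "\<lambda>l i. if i \<in> {1..n} then real (l ! (i - 1)) else 0"
  let ?g = "\<lambda>x. map (\<lambda>i. nat \<lfloor>x (Suc i)\<rfloor>) [0..<n]"
  show "\<forall>l\<in>{l. length l = n \<and> sum_list l = m}. ?g (?f l) = l"
    by (auto intro!: nth_equalityI)
  have nat_floor: "real (nat \<lfloor>x i\<rfloor>) = x i" if "x \<in> lattice_Delta n m" "i \<in> {1..n}" for x i
  proof -
    have "x i \<in> \<int>" "x i \<ge> 0"
      using that by (auto simp: Delta_def lattice_points_def)
    then show ?thesis by (auto elim!: Ints_cases)
  qed
  show "\<forall>x\<in>lattice_Delta n m. ?f (?g x) = x"
  proof (intro ballI ext)
    fix x i assume x: "x \<in> lattice_Delta n m"
    show "?f (?g x) i = x i"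
    proof (cases "i \<in> {1..n}")
      case True
      then obtain m where "i = Suc m" "m < n" by (cases i) auto
      then show ?thesis using nat_floor[OF x True] by simp
    next
      case False
      then show ?thesis using x by (auto simp: Delta_def rspace_def)
    qed
  qed
  show "?f ` {l. length l = n \<and> sum_list l = m} \<subseteq> lattice_Delta n m"
  proof clarify
    fix l :: "nat list" assume n: "n = length l" and m: "m = sum_list l"
    have "(\<Sum>i=1..length l. real (l ! (i - 1))) = (\<Sum>i<length l. real (l ! i))"
      by (rule sum.reindex_bij_witness[of _ Suc "\<lambda>i. i - 1"]) auto
    also have "\<dots> = real (sum_list l)"
      by (simp add: sum_list_sum_nth atLeast0LessThan)
    finally show "(\<lambda>i. if i \<in> {1..length l} then real (l ! (i - 1)) else 0)
        \<in> lattice_Delta (length l) (sum_list l)"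
      by (auto simp: Delta_def lattice_points_def rspace_def)
  qed
  show "?g ` lattice_Delta n m \<subseteq> {l. length l = n \<and> sum_list l = m}"
  proof clarify
    fix x assume x: "x \<in> Delta n m" "x \<in> lattice_points n"
    have "real (sum_list (?g x)) = (\<Sum>i<n. real (nat \<lfloor>x (Suc i)\<rfloor>))"
      by (simp add: interv_sum_list_conv_sum_set_nat atLeast0LessThan)
    also have "\<dots> = (\<Sum>i=1..n. real (nat \<lfloor>x i\<rfloor>))"
      by (rule sum.reindex_bij_witness[of _ "\<lambda>i. i - 1" Suc]) auto
    also have "\<dots> = (\<Sum>i=1..n. x i)"
      using nat_floor x by (intro sum.cong) auto
    also have "\<dots> = real m" using x by (simp add: Delta_def)
    finally have "sum_list (?g x) = m" by (simp only: of_nat_eq_iff)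
    then show "length (?g x) = n \<and> sum_list (?g x) = m" by simp
  qed
qed

lemma card_lattice_Delta: "card (lattice_Delta n m) = (m + n - 1) choose m"
  using bij_betw_same_card[OF bij_betw_lists_lattice_Delta] card_length_sum_list[of n m] by simp

lemma finite_lattice_Delta: "finite (lattice_Delta n m)"
proof -
  have "{l. length l = n \<and> sum_list l = m} \<subseteq> {l. set l \<subseteq> {..m} \<and> length l = n}"
    using member_le_sum_list by auto
  then have "finite {l. length l = n \<and> sum_list l = m}"
    by (rule finite_subset) (rule finite_lists_length_eq[OF finite_atMost])
  then show ?thesis
    using bij_betw_finite[OF bij_betw_lists_lattice_Delta] by simp
qed

text \<open>The increment \<open>d\<close> is real so that the same rule serves for adding a unit
  vector and for subtracting one.\<close>

lemma sum_fun_upd_add: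
  fixes b :: "nat \<Rightarrow> real"
  assumes "finite A" "j \<in> A"
  shows "sum (b(j := b j + d)) A = sum b A + d"
  using assms by (simp add: sum.remove[of A j])

lemma add_unit_lattice_Delta:
  assumes "b \<in> lattice_Delta k q" "j \<in> {1..k}"
  shows "b(j := b j + 1) \<in> lattice_Delta k (Suc q)"
proof -
  have "sum (b(j := b j + 1)) {1..k} = real (Suc q)"
    using assms by (simp add: sum_fun_upd_add Delta_def del: fun_upd_apply)
  moreover have "(b(j := b j + 1)) i \<ge> 0" if "i \<in> {1..k}" for i
    using assms that by (auto simp: Delta_def)
  moreover have "b(j := b j + 1) \<in> lattice_points k"
    using assms by (auto simp: lattice_points_def rspace_def)
  ultimately show ?thesis
    unfolding Delta_def lattice_points_def by blast
qed

section \<open>The cells of the triangulation\<close>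

text \<open>For \<open>b\<close> in \<open>Delta k p\<close> and \<open>q = Suc p\<close>, the
  differences x - b are nonnegative with sum 1, so this is the standard simplex translated by b.
  Lower bounds are used instead of a convex hull because they match the inequalities in
  \<open>sigma\<close> one by one.\<close>

definition cell :: "nat \<Rightarrow> nat \<Rightarrow> (nat \<Rightarrow> real) \<Rightarrow> (nat \<Rightarrow> real) set" where
  "cell k q b = {x \<in> Delta k q. \<forall>i\<in>{1..k}. b i \<le> x i}"

text \<open>The inverse of \<open>phi\<close>. Coordinate k of \<open>x\<close> is dropped, since
  the prescribed total determines it; the value 0 elsewhere is the normalisation of
  \<open>rspace\<close>.\<close>

definition partial_sums :: "nat \<Rightarrow> (nat \<Rightarrow> real) \<Rightarrow> nat \<Rightarrow> real" where
  "partial_sums k x i = (if i \<in> {1..k - 1} then \<Sum>j=1..i. x j else 0)"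

section \<open>The map \<open>phi\<close> and its right inverse by partial sums\<close>

lemma sum_phi:
  assumes "m \<in> {1..k - 1}"
  shows "(\<Sum>i=1..m. phi k q y i) = y m"
  using assms
proof (induction m)
  case (Suc m)
  then show ?case by (cases "m = 0") (auto simp: phi_def)
qed simp

lemma sum_phi_k:
  assumes "k \<ge> 2"
  shows "(\<Sum>i=1..k. phi k q y i) = real q"
proof -
  obtain n where k: "k = Suc n" and n: "n \<ge> 1" using assms by (cases k) auto
  show ?thesis
    using sum_phi[of n k q y] k n by (simp add: phi_def)
qed

lemma phi_partial_sums:
  assumes "k \<ge> 2" "x \<in> Delta k q"
  shows "phi k q (partial_sums k x) = x"
proof
  fix i
  obtain n where k: "k = Suc n" and n: "n \<ge> 1" using assms by (cases k) auto
  have total: "(\<Sum>j=1..n. x j) + x k = real q"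
    using assms k by (simp add: Delta_def)
  have out: "x i = 0" if "i \<notin> {1..k}"
    using assms that by (auto simp: Delta_def rspace_def)
  consider "i = 1" | "i \<in> {2..k - 1}" | "i = k" "i \<noteq> 1" | "i \<notin> {1..k}" by atomize_elim auto
  then show "phi k q (partial_sums k x) i = x i"
  proof cases
    case 2
    then obtain m where "i = Suc m" "m \<ge> 1" by (cases i) auto
    then show ?thesis using 2 by (auto simp: phi_def partial_sums_def)
  next
    case 3
    then show ?thesis using k n total by (auto simp: phi_def partial_sums_def)
  qed (use assms out in \<open>auto simp: phi_def partial_sums_def\<close>)
qed

text \<open>Put x = \<open>phi k (Suc p) y\<close> and let w be the partial sums of b. For the
  identity permutation the chain defining \<open>sigma\<close> unwinds coordinatewise: its first
  inequality says b_1 <= x_1, each middle one says b_(i+1) <= x_(i+1), and the last says b_k <= x_k.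
  The bound 1 in the last one is the difference between the totals \<open>Suc p\<close> and
  \<open>p\<close>.\<close>

lemma phi_sigma_id:
  assumes k: "k \<ge> 2" and b: "b \<in> Delta k p"
  shows "phi k (Suc p) ` sigma k (partial_sums k b) id = cell k (Suc p) b"
proof
  obtain n where kn: "k = Suc n" and n: "n \<ge> 1" using k by (cases k) auto
  have total: "(\<Sum>j=1..n. b j) + b k = real p"
    using b kn by (simp add: Delta_def)
  have b0: "b i \<ge> 0" if "i \<in> {1..k}" for i using b that by (auto simp: Delta_def)
  show "phi k (Suc p) ` sigma k (partial_sums k b) id \<subseteq> cell k (Suc p) b"
  proof clarify
    fix y assume y: "y \<in> sigma k (partial_sums k b) id"
    have le: "b i \<le> phi k (Suc p) y i" if i: "i \<in> {1..k}" for i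
    proof -
      consider "i = 1" | "i \<in> {2..k - 1}" | "i = k" "i \<noteq> 1" using i by atomize_elim auto
      then show ?thesis
      proof cases
        case 1
        then show ?thesis using y kn n by (auto simp: sigma_def phi_def partial_sums_def)
      next
        case 2
        then obtain m where m: "i = Suc m" "m \<in> {1..<k - 1}" by (cases i) auto
        then have "y m - partial_sums k b m \<le> y (Suc m) - partial_sums k b (Suc m)"
          using y by (auto simp: sigma_def)
        then show ?thesis using m by (auto simp: phi_def partial_sums_def)
      next
        case 3
        have "y n - partial_sums k b n \<le> 1" using y kn by (auto simp: sigma_def)
        then show ?thesis using 3 total kn n by (auto simp: phi_def partial_sums_def)
      qed
    qed
    have "0 \<le> phi k (Suc p) y i" if "i \<in> {1..k}" for i
      using le[OF that] b0[OF that] by linarith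
    moreover have "phi k (Suc p) y \<in> rspace k"
      using k by (auto simp: rspace_def phi_def)
    ultimately show "phi k (Suc p) y \<in> cell k (Suc p) b"
      using le sum_phi_k[OF k, of "Suc p" y] by (simp add: cell_def Delta_def)
  qed
  show "cell k (Suc p) b \<subseteq> phi k (Suc p) ` sigma k (partial_sums k b) id"
  proof
    fix x assume x: "x \<in> cell k (Suc p) b"
    then have xD: "x \<in> Delta k (Suc p)" and bx: "\<And>i. i \<in> {1..k} \<Longrightarrow> b i \<le> x i"
      by (auto simp: cell_def)
    have x0: "x i \<ge> 0" if "i \<in> {1..k}" for i using xD that by (auto simp: Delta_def)
    have xtotal: "(\<Sum>j=1..n. x j) + x k = real p + 1"
      using xD kn by (simp add: Delta_def)
    have "partial_sums k x \<in> sigma k (partial_sums k b) id"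
      unfolding sigma_def
    proof (intro CollectI conjI ballI)
      show "partial_sums k x \<in> rspace (k - 1)" by (auto simp: rspace_def partial_sums_def)
      show "0 \<le> partial_sums k x i" for i
        using x0 by (auto simp: partial_sums_def intro!: sum_nonneg)
      show "0 \<le> partial_sums k x (id 1) - partial_sums k b (id 1)"
        using bx[of 1] k by (auto simp: partial_sums_def)
      show "partial_sums k x (id i) - partial_sums k b (id i)
          \<le> partial_sums k x (id (i + 1)) - partial_sums k b (id (i + 1))"
        if "i \<in> {1..<k - 1}" for i
        using that bx[of "i + 1"] by (auto simp: partial_sums_def)
      show "partial_sums k x (id (k - 1)) - partial_sums k b (id (k - 1)) \<le> 1"
        using bx[of k] total xtotal kn n by (auto simp: partial_sums_def)
    qed
    then show "x \<in> phi k (Suc p) ` sigma k (partial_sums k b) id"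
      using phi_partial_sums[OF k xD] by force
  qed
qed

text \<open>The identity is consistent with every w. The sum of b being \<open>p\<close> keeps the
  last coordinate of w at most \<open>p\<close>, which leaves room for the increase by 1 inside
  \<open>R k (Suc p)\<close>.\<close>

lemma cell_in_triangulation:
  assumes k: "k \<ge> 2" and b: "b \<in> lattice_Delta k p"
  shows "cell k (Suc p) b \<in> triangulation k (Suc p)"
proof -
  let ?w = "partial_sums k b"
  obtain n where kn: "k = Suc n" and n: "n \<ge> 1" using k by (cases k) auto
  have total: "(\<Sum>j=1..n. b j) + b k = real p"
    using b kn by (simp add: Delta_def)
  have b0: "b i \<ge> 0" if "i \<in> {1..k}" for i using b that by (auto simp: Delta_def)
  have mono: "?w i \<le> ?w (i + 1)" if "i \<in> {1..<k - 1}" for i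
    using b0[of "i + 1"] that by (auto simp: partial_sums_def)
  have last: "?w (k - 1) \<le> real p"
    using total b0[of k] kn n by (auto simp: partial_sums_def)
  have w: "?w \<in> W k (Suc p)"
  proof -
    have "?w 1 \<ge> 0" using b0[of 1] k by (auto simp: partial_sums_def)
    moreover have "?w i \<in> \<int>" for i
      using b by (auto simp: partial_sums_def lattice_points_def)
    moreover have "?w \<in> rspace (k - 1)" by (auto simp: rspace_def partial_sums_def)
    ultimately show ?thesis
      using mono last by (auto simp: W_def R_def lattice_points_def)
  qed
  have "sigma k ?w id \<subseteq> R k (Suc p)"
  proof
    fix y assume y: "y \<in> sigma k ?w id"
    have "y i \<le> y (i + 1)" if "i \<in> {1..<k - 1}" for i
    proof -
      have "y i - ?w i \<le> y (i + 1) - ?w (i + 1)" using y that by (auto simp: sigma_def)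
      then show ?thesis using mono[OF that] by linarith
    qed
    moreover have "y (k - 1) \<le> real (Suc p)"
    proof -
      have "y (k - 1) - ?w (k - 1) \<le> 1" using y by (auto simp: sigma_def)
      then show ?thesis using last by simp
    qed
    ultimately show "y \<in> R k (Suc p)" using y k by (auto simp: R_def sigma_def)
  qed
  moreover have "consistent k ?w id"
    by (auto simp: consistent_def permutes_id inv_id)
  ultimately show ?thesis
    using w phi_sigma_id[OF k, of b p] b unfolding triangulation_def by blast
qed

section \<open>Vertices of a cell, and recovering b from its cell\<close>

lemma add_unit_in_cell:
  assumes "b \<in> lattice_Delta k p" "j \<in> {1..k}"
  shows "b(j := b j + 1) \<in> cell k (Suc p) b"
  using add_unit_lattice_Delta[OF assms] by (auto simp: cell_def)

text \<open>All coordinates of b + e_j other than the j-th attain the lower bounds of the cell, so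
  the endpoints of a segment through this point attain them too. The common total then fixes
  coordinate j, and the endpoints coincide.\<close>

lemma add_unit_in_vertices_cell:
  assumes b: "b \<in> lattice_Delta k p" and j: "j \<in> {1..k}"
  shows "b(j := b j + 1) \<in> vertices (cell k (Suc p) b)"
proof -
  have False
    if a: "a \<in> cell k (Suc p) b" and c: "c \<in> cell k (Suc p) b" and "a \<noteq> c"
      and t: "0 < t" "t < 1" and eq: "b(j := b j + 1) = (\<lambda>i. (1 - t) * a i + t * c i)"
    for a c and t :: real
  proof -
    have off: "a i = b i \<and> c i = b i" if i: "i \<in> {1..k} - {j}" for i
    proof -
      have "b i = (1 - t) * a i + t * c i" using fun_cong[OF eq, of i] i by simp
      \<comment> \<open>A convex combination of two nonnegative excesses over b_i vanishes only if
        both excesses do, as both weights are positive.\<close>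
      then have sum0: "(1 - t) * (a i - b i) + t * (c i - b i) = 0" by (simp add: algebra_simps)
      have "a i - b i \<ge> 0" "c i - b i \<ge> 0" using a c i by (auto simp: cell_def)
      then have "(1 - t) * (a i - b i) \<ge> 0" "t * (c i - b i) \<ge> 0" using t by auto
      then have "(1 - t) * (a i - b i) = 0" "t * (c i - b i) = 0" using sum0 by linarith+
      then show ?thesis using t by auto
    qed
    have "sum a ({1..k} - {j}) = sum c ({1..k} - {j})"
      using off by (intro sum.cong) auto
    moreover have "sum a {1..k} = sum c {1..k}"
      using a c by (auto simp: cell_def Delta_def)
    ultimately have "a j = c j"
      using j sum.remove[of "{1..k}" j a] sum.remove[of "{1..k}" j c] by simp
    then have "a i = c i" for i
      using off[of i] a c by (cases "i \<in> {1..k}"; cases "i = j")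
        (auto simp: cell_def Delta_def rspace_def)
    then show False using \<open>a \<noteq> c\<close> by auto
  qed
  then show ?thesis
    using add_unit_in_cell[OF b j] unfolding vertices_def by blast
qed

text \<open>The point b is the coordinatewise minimum of its cell: coordinate i attains b_i at the
  vertex b + e_j for any j different from i, and such a j exists because k is at least 2.\<close>

lemma inj_on_cell:
  assumes "k \<ge> 2"
  shows "inj_on (cell k (Suc p)) (lattice_Delta k p)"
proof -
  have le: "b i \<le> b' i"
    if b': "b' \<in> lattice_Delta k p" and eq: "cell k (Suc p) b = cell k (Suc p) b'"
      and i: "i \<in> {1..k}" for b b' i
  proof -
    obtain j where j: "j \<in> {1..k}" "j \<noteq> i"
      using assms by (cases "i = 1") (auto intro: that[of 1] that[of 2])
    have "b'(j := b' j + 1) \<in> cell k (Suc p) b"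
      using add_unit_in_cell[OF b' j(1)] eq by simp
    then have "b i \<le> (b'(j := b' j + 1)) i" using i unfolding cell_def by blast
    then show ?thesis using j by simp
  qed
  show ?thesis
  proof (rule inj_onI, rule ext)
    fix b b' i
    assume b: "b \<in> lattice_Delta k p" and b': "b' \<in> lattice_Delta k p"
      and eq: "cell k (Suc p) b = cell k (Suc p) b'"
    show "b i = b' i"
      using le[OF b' eq, of i] le[OF b eq[symmetric], of i] b b'
      by (cases "i \<in> {1..k}") (auto simp: Delta_def rspace_def)
  qed
qed

text \<open>Needed because \<open>card\<close> is 0 on infinite sets. The monotone chain puts every
  coordinate of w between 0 and q, so there are finitely many pairs of w and a permutation.\<close>

lemma finite_triangulation:
  assumes k: "k \<ge> 2"
  shows "finite (triangulation k q)"
proof -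
  have "W k q \<subseteq> {w. \<forall>i. (i \<in> {1..k - 1} \<longrightarrow> w i \<in> real ` {..q}) \<and> (i \<notin> {1..k - 1} \<longrightarrow> w i = 0)}"
  proof (intro subsetI CollectI allI conjI impI)
    fix w i assume w: "w \<in> W k q"
    show "w i = 0" if "i \<notin> {1..k - 1}"
      using w that by (auto simp: W_def R_def rspace_def)
    assume i: "i \<in> {1..k - 1}"
    have mono: "w m \<le> w (Suc m)" if "m \<in> {1..<k - 1}" for m
      using w that by (auto simp: W_def R_def)
    have "w 1 \<le> w i"
    proof -
      have "1 \<le> i" using i by simp
      then show ?thesis using i
      proof (induction rule: dec_induct)
        case (step m)
        then show ?case using mono[of m] by auto
      qed simp
    qed
    moreover have "w i \<le> w (k - 1)"
    proof -
      have "i \<le> k - 1" using i by simp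
      then show ?thesis using i
      proof (induction rule: inc_induct)
        case (step m)
        then show ?case using mono[of m] by auto
      qed simp
    qed
    moreover have "0 \<le> w 1" "w (k - 1) \<le> real q" "w i \<in> \<int>"
      using w by (auto simp: W_def R_def lattice_points_def)
    ultimately have "0 \<le> w i" "w i \<le> real q" "w i \<in> \<int>" by auto
    then have "w i \<in> \<nat>" by (simp add: Nats_altdef2)
    then show "w i \<in> real ` {..q}" using \<open>w i \<le> real q\<close> by (auto elim!: Nats_cases)
  qed
  then have "finite (W k q)"
    by (rule finite_subset) (intro finite_set_of_finite_funs; simp)
  moreover have "finite {\<pi>. \<pi> permutes {1..k - 1}}" by (simp add: finite_permutations)
  ultimately have "finite ((\<lambda>(w, \<pi>). phi k q ` sigma k w \<pi>) ` (W k q \<times> {\<pi>. \<pi> permutes {1..k - 1}}))"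
    by simp
  then show ?thesis
    by (rule rev_finite_subset) (auto simp: triangulation_def consistent_def)
qed

section \<open>Monochromatic cells\<close>

lemma monochromatic_cell_label:
  assumes "b \<in> lattice_Delta k p" "monochromatic c (cell k (Suc p) b)"
    "i \<in> {1..k}" "j \<in> {1..k}"
  shows "c (b(i := b i + 1)) = c (b(j := b j + 1))"
  using assms add_unit_in_vertices_cell unfolding monochromatic_def by blast

text \<open>Since points vanish outside their coordinate range,
  \<open>lattice_Delta (k - 1) p\<close> is the face of \<open>lattice_Delta k p\<close> where
  coordinate k is 0. The injection \<open>shift\<close> sends the monochromatic base points into the
  complement of that face.\<close>

lemma card_nonmonochromatic_cells:
  assumes k: "k \<ge> 2" and c: "sperner_labeling k (Suc p) c"
  shows "card (lattice_Delta (k - 1) p)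
    \<le> card {b \<in> lattice_Delta k p. \<not> monochromatic c (cell k (Suc p) b)}"
proof -
  define M where "M = {b \<in> lattice_Delta k p. monochromatic c (cell k (Suc p) b)}"
  \<comment> \<open>The vertex b + e_k is an arbitrary choice; for monochromatic cells
    \<open>label_eq\<close> gives the same value at every vertex.\<close>
  define label where "label b = c (b(k := b k + 1))" for b
  define down where "down b = b(label b := b (label b) - 1)" for b :: "nat \<Rightarrow> real"
  \<comment> \<open>Two successive updates, so that the case \<open>label b = k\<close>, where they
    cancel, needs no special treatment.\<close>
  define shift where "shift b = (down b)(k := down b k + 1)" for b
  have label: "label b \<in> {1..k}" if "b \<in> M" for b
    using c add_unit_lattice_Delta[of b k p k] that k
    unfolding label_def sperner_labeling_def M_def by auto
  have label_eq: "c (b(j := b j + 1)) = label b" if "b \<in> M" "j \<in> {1..k}" for b j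
    using monochromatic_cell_label[of b k p c j k] that k by (auto simp: M_def label_def)
  have pos: "b (label b) \<ge> 1" if b: "b \<in> M" for b
  proof -
    \<comment> \<open>Adding e_j leaves coordinate \<open>label b\<close> unchanged, so the Sperner
      condition at the vertex b + e_j speaks about b itself.\<close>
    obtain j where j: "j \<in> {1..k}" "j \<noteq> label b"
      using k by (cases "label b = 1") (auto intro: that[of 1] that[of 2])
    have "b(j := b j + 1) \<in> lattice_Delta k (Suc p)"
      using add_unit_lattice_Delta b j by (auto simp: M_def)
    then have "(b(j := b j + 1)) (label b) \<noteq> 0"
      using c label_eq[OF b j(1)] label[OF b] unfolding sperner_labeling_def by blast
    then have "b (label b) \<noteq> 0" using j by simp
    moreover have "b (label b) \<ge> 0" "b (label b) \<in> \<int>"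
      using b label[OF b] by (auto simp: M_def Delta_def lattice_points_def)
    ultimately show ?thesis by (auto elim!: Ints_cases)
  qed
  have down: "down b \<in> lattice_points k" "\<forall>i\<in>{1..k}. 0 \<le> down b i"
    \<comment> \<open>The difference is taken in the reals, so \<open>p = 0\<close> is covered; in
      that case nonnegativity shows that \<open>M\<close> is empty.\<close>
    "(\<Sum>i=1..k. down b i) = real p - 1" if b: "b \<in> M" for b
  proof -
    show "down b \<in> lattice_points k"
      using b label[OF b] by (auto simp: down_def M_def lattice_points_def rspace_def)
    show "\<forall>i\<in>{1..k}. 0 \<le> down b i"
      using b pos[OF b] by (auto simp: down_def M_def Delta_def)
    show "(\<Sum>i=1..k. down b i) = real p - 1"
      using sum_fun_upd_add[of "{1..k}" "label b" b "-1"] label[OF b] b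
      by (simp add: down_def M_def Delta_def del: fun_upd_apply)
  qed
  have shift_mem: "shift b \<in> lattice_Delta k p - lattice_Delta (k - 1) p" if b: "b \<in> M" for b
  proof -
    have "(\<Sum>i=1..k. shift b i) = real p"
      using sum_fun_upd_add[of "{1..k}" k "down b" 1] down(3)[OF b] k
      by (simp add: shift_def del: fun_upd_apply)
    \<comment> \<open>A nonzero coordinate k is what excludes membership in
      \<open>rspace (k - 1)\<close>, and so in the face.\<close>
    moreover have "shift b k > 0"
      using down(2)[OF b] k by (auto simp: shift_def intro: add_nonneg_pos)
    ultimately show ?thesis
      using down(1,2)[OF b] k
      by (auto simp: shift_def Delta_def lattice_points_def rspace_def intro!: bexI[of _ k])
  qed
  have "inj_on shift M"
  proof (rule inj_onI)
    fix b b' assume b: "b \<in> M" and b': "b' \<in> M" and "shift b = shift b'"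
    then have "shift b i = shift b' i" for i by simp
    then have "down b i = down b' i" for i
      unfolding shift_def by (cases "i = k") (metis add_right_cancel fun_upd_apply)+
    then have eq: "down b = down b'" by auto
    show "b = b'"
    proof (cases "label b = label b'")
      case True
      have "b = (down b)(label b := down b (label b) + 1)"
        "b' = (down b')(label b' := down b' (label b') + 1)"
        by (auto simp: down_def)
      then show ?thesis using eq True by metis
    next
      case False
      \<comment> \<open>Both sides are the common point \<open>down b\<close> plus the unit vectors
        of the two labels. It is a vertex of both cells, so it carries both labels.\<close>
      have "b(label b' := b (label b') + 1)
          = (down b)(label b := down b (label b) + 1, label b' := down b (label b') + 1)"
        using False by (auto simp: down_def)
      also have "\<dots> = b'(label b := b' (label b) + 1)"
        using False unfolding eq by (auto simp: down_def)
      finally have "label b = label b'"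
        using label_eq[OF b label[OF b']] label_eq[OF b' label[OF b]] by simp
      then show ?thesis using False by simp
    qed
  qed
  then have "card M \<le> card (lattice_Delta k p - lattice_Delta (k - 1) p)"
    using shift_mem finite_lattice_Delta by (intro card_inj_on_le[of shift]) auto
  moreover have sub: "lattice_Delta (k - 1) p \<subseteq> lattice_Delta k p"
  proof
    fix x assume x: "x \<in> lattice_Delta (k - 1) p"
    obtain n where n: "k = Suc n" using k by (cases k) auto
    have "x k = 0" using x n by (auto simp: Delta_def rspace_def)
    then show "x \<in> lattice_Delta k p"
      using x n by (auto simp: Delta_def rspace_def lattice_points_def le_Suc_eq)
  qed
  then have "card (lattice_Delta k p - lattice_Delta (k - 1) p)
      = card (lattice_Delta k p) - card (lattice_Delta (k - 1) p)"
    using card_Diff_subset[OF finite_lattice_Delta] by blast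
  \<comment> \<open>Subtraction of naturals truncates, so the final rearrangement needs this
    inequality.\<close>
  moreover have "card (lattice_Delta (k - 1) p) \<le> card (lattice_Delta k p)"
    using card_mono[OF finite_lattice_Delta sub] .
  moreover have "{b \<in> lattice_Delta k p. \<not> monochromatic c (cell k (Suc p) b)}
      = lattice_Delta k p - M"
    by (auto simp: M_def)
  moreover have "card (lattice_Delta k p - M) = card (lattice_Delta k p) - card M"
    by (intro card_Diff_subset finite_subset[OF _ finite_lattice_Delta]) (auto simp: M_def)
  ultimately show ?thesis by (simp only:) linarith
qed

section \<open>From cells to the minimum over all labelings\<close>

lemma num_nonmono_ge:
  assumes k: "k \<ge> 2" and c: "sperner_labeling k (Suc p) c"
  shows "(p + (k - 1) - 1) choose p \<le> num_nonmono k (Suc p) c"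
proof -
  let ?B = "{b \<in> lattice_Delta k p. \<not> monochromatic c (cell k (Suc p) b)}"
  have "card (lattice_Delta (k - 1) p) \<le> card ?B"
    using card_nonmonochromatic_cells[OF k c] .
  also have "\<dots> \<le> card {S \<in> triangulation k (Suc p). \<not> monochromatic c S}"
  \<comment> \<open>Distinct base points give distinct simplices, so passing from points to cells
    loses nothing; simplices for other permutations only increase the right-hand side.\<close>
  proof (rule card_inj_on_le)
    show "inj_on (cell k (Suc p)) ?B"
      using inj_on_cell[OF k] by (rule inj_on_subset) auto
    show "cell k (Suc p) ` ?B \<subseteq> {S \<in> triangulation k (Suc p). \<not> monochromatic c S}"
      using cell_in_triangulation[OF k] by auto
    show "finite {S \<in> triangulation k (Suc p). \<not> monochromatic c S}"
      using finite_triangulation[OF k] by simp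
  qed
  finally show ?thesis by (simp only: card_lattice_Delta num_nonmono_def)
qed

text \<open>Ensures that \<open>Min\<close> is taken over a nonempty set. A point with coordinate
  sum q >= 1 has a nonzero coordinate, whose index can serve as its label.\<close>

lemma sperner_labeling_exists:
  assumes "q \<ge> 1"
  shows "\<exists>c. sperner_labeling k q c"
proof -
  have "\<exists>i\<in>{1..k}. v i \<noteq> 0" if "v \<in> Delta k q" for v
  proof (rule ccontr)
    assume "\<not> ?thesis"
    then have "(\<Sum>i=1..k. v i) = 0" by (intro sum.neutral) auto
    then show False using that assms by (auto simp: Delta_def)
  qed
  then have "\<forall>v\<in>Delta k q. \<exists>i. i \<in> {1..k} \<and> v i \<noteq> 0" by blast
  then obtain c where "\<forall>v\<in>Delta k q. c v \<in> {1..k} \<and> v (c v) \<noteq> 0"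
    by (rule bchoice[THEN exE])
  then have "sperner_labeling k q c" unfolding sperner_labeling_def by blast
  then show ?thesis by blast
qed

theorem theorem1p1:
  fixes k q :: nat
  assumes "k \<ge> 2" and "q \<ge> 1"
  shows "min_nonmono k q \<ge> (q + k - 3) choose (k - 2)"
proof -
  let ?N = "{num_nonmono k q c | c. sperner_labeling k q c}"
  \<comment> \<open>Labelings are functions on an infinite type, so finiteness comes from bounding
    the counts rather than from counting labelings.\<close>
  have "?N \<subseteq> {..card (triangulation k q)}"
    unfolding num_nonmono_def using finite_triangulation[OF assms(1)] by (auto intro!: card_mono)
  then have "finite ?N" by (rule finite_subset) simp
  moreover have "?N \<noteq> {}" using sperner_labeling_exists[OF assms(2)] by auto
  ultimately have "Min ?N \<in> ?N" by (rule Min_in)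
  then obtain c where c: "min_nonmono k q = num_nonmono k q c" "sperner_labeling k q c"
    by (auto simp: min_nonmono_def)
  obtain p where p: "q = Suc p" using assms(2) by (cases q) auto
  obtain m where m: "k = m + 2" using assms(1) by (metis add.commute le_Suc_ex)
  \<comment> \<open>With q = p + 1 and k = m + 2 the goal has lower index m, whereas the count of
    lattice points has lower index p.\<close>
  have "(p + m) choose m = (p + m) choose p"
    using binomial_symmetric[of m "p + m"] by simp
  then show ?thesis
    using num_nonmono_ge[OF assms(1), of p c] c p m by simp
qed

end
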